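(* Suppose that $-1\le\sigma<\frac bq$, where $\sigma=\frac bq\big(l-1+\frac{p-1}{h-1}\big)-\frac aq$. Suppose that there is an integer $L$ with $0\le L\le\min\{N-M,2M-1\}$ such that $\Lambda_K\equiv0$ for all $K<L$ and $\Lambda_L\not\equiv0$, and that $\Lambda_L(\varrho,\varphi)\ne0$ for all $(\varrho,\varphi)\in\mathbb R^2$. Then, for sufficiently large $n\ge L$, the solutions of the truncated system $$\frac{d\varrho}{d\tau}=\sum_{K=L}^n\tau^{-\frac{M+K}N}\Lambda_K(\varrho,\varphi),\qquad \frac{d\varphi}{d\tau}=\sum_{K=0}^n\tau^{-\frac{M+K}N}\Omega_K(\varrho,\varphi)$$ exit from any bounded domain of the $(\varrho,\varphi)$-plane in a finite time.
   Context: Setting. $h\ge2$, $a,b,q$ are integers with $1\le a,b\le q$; $l,p$ are integers with $0\le l\le p\le 2h-1$; $s>0$; $S(t)=st^{1+b/q}$; $H(x,y)=\frac{y^2}{2}+U(x)$, $U(x)=\frac{x^{2h}}{2h}+\sum_{i=1}^{2h-1}u_ix^i$ with real constants $u_i$. The functions $f(x,y,S,t)$, $g(x,y,S,t)$ are infinitely differentiable for $(x,y,S)\in\mathbb R^3$, $t>0$, $2\pi$-periodic in $S$, and have power-law asymptotics as $t\to\infty$: $f=\sum_{k\ge0}t^{-k/q}f_k(x,y,S)$, $g=\sum_{k\ge0}t^{-k/q}g_k(x,y,S)$ with $f_k=\sum_{i=0}^p\sum_{j=0}^{l-1}A_{k,i,j}(S)x^iy^j$, $g_k=\sum_{i=0}^p\sum_{j=0}^{l}B_{k,i,j}(S)x^iy^j$,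 where $A_{k,i,j},B_{k,i,j}$ are $2\pi$-periodic and vanish identically if $i+j>p$. The perturbed system is $\dot x=\partial_yH+t^{-a/q}f(x,y,S(t),t)$, $\dot y=-\partial_xH+t^{-a/q}g(x,y,S(t),t)$. Energy-angle variables. $E_0>0$ is such that for all $E>E_0$ the level lines $\{H=E\}$ are closed curves containing no fixed points of $\dot x=\partial_yH$, $\dot y=-\partial_xH$. For $E>E_0$ let $x_0(t,E),y_0(t,E)$ be the corresponding periodic solution (depending smoothly on $E$), $T(E)$ its period, $\omega(E)=2\pi/T(E)$, $X(\phi,E)=x_0(\phi/\omega(E),E)$, $Y(\phi,E)=y_0(\phi/\omega(E),E)$. The initial phase of the family is chosen so that, as $E\to\infty$, $X=E^{\frac1{2h}}\sum_{j\ge0}E^{-\frac j{2h}}X_j(\phi)$, $Y=E^{\frac12}\sum_{j\ge0}E^{-\frac j{2h}}Y_j(\phi)$, $\omega=E^{\frac{h-1}{2h}}\sum_{j\ge0}E^{-\frac j{2h}}\omega_j$ with $2\pi$-periodic $X_j,Y_j$ and constants $\omega_j$, $\omega_0=2\pi/\kappa$, $\kappa=\sqrt2(2h)^{\frac1{2h}}\int_{-1}^1\frac{d\varsigma}{\sqrt{1-\varsigma^{2h}}}$. With $X=X(\phi,I)$, $Y=Y(\phi,I)$ put $F(I,\phi,S,t)=f(X,Y,S,t)U'(X)+g(X,Y,S,t)Y$, $G(I,\phi,S,t)=\omega(I)\big(f(X,Y,S,t)\partial_EY-g(X,Y,S,t)\partial_EX\big)$. Rescaled variables. $\varkappa$ is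 a fixed positive integer. $E_1\ge E_0$ is such that $\omega'(E)>0$ for $E\ge E_1$, and $I_\ast(t)\ge E_1$ is the smooth solution, defined for $t\ge t_1$ with some $t_1>0$, of $\omega(I_\ast(t))=\varkappa^{-1}S'(t)$. Constants: $\vartheta=s(1+\frac bq)$, $\mu=\frac12(\frac bq-\sigma)>0$, $\nu=1+2\mu+\sigma=1+\frac bq$, $M=2\mu q(h-1)$, $N=2\nu q(h-1)$ (integers). The variables $r,\theta,\tau$ are defined by $x=X(\phi,I)$, $y=Y(\phi,I)$, $I=I_\ast(t)(1+t^{-\mu}r)^{2h}$, $\phi=\theta+\varkappa^{-1}S(t)$, $\tau=t^\nu/\nu$; $\zeta(\tau)=S(t)=\vartheta\tau$. They satisfy $\frac{dr}{d\tau}=\tau^{-\frac MN}\mathcal A(r,\theta,\zeta(\tau),\tau)$, $\frac{d\theta}{d\tau}=\tau^{-\frac MN}\mathcal B(r,\theta,\zeta(\tau),\tau)$, where, with $t=(\nu\tau)^{1/\nu}$, $I=I_\ast(t)(1+t^{-\mu}r)^{2h}$, $\phi=\theta+\varkappa^{-1}\zeta$, $$\tau^{-\frac MN}\mathcal A=t^{1-\nu+\mu}\Big[\frac{t^{-a/q}F(I,\phi,\zeta,t)}{2hI_\ast(t)(1+t^{-\mu}r)^{2h-1}}-\frac{I_\ast'(t)}{2hI_\ast(t)}(1+t^{-\mu}r)+\mu t^{-\mu-1}r\Big],$$ $$\tau^{-\frac MN}\mathcal B=t^{1-\nu}\big[\omega(I)-\omega(I_\ast(t))+t^{-a/q}G(I,\phi,\zeta,t)\big].$$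 Inserting the asymptotic series of $f,g,X,Y,\omega,I_\ast$ gives, as $\tau\to\infty$ uniformly for bounded $r$ and $\theta\in\mathbb R$, $\mathcal A=\sum_{K\ge0}\tau^{-\frac KN}\mathcal A_K(r,\theta,\zeta)$, $\mathcal B=\sum_{K\ge0}\tau^{-\frac KN}\mathcal B_K(r,\theta,\zeta)$, with $\mathcal A_K,\mathcal B_K$ polynomial in $r$, $2\pi$-periodic in $\theta$, $2\pi\varkappa$-periodic in $\zeta$. Averaging. The functions $\Lambda_K(r,\theta),\Omega_K(r,\theta),\rho_K(r,\theta,\zeta),\psi_K(r,\theta,\zeta)$, $K\ge0$ (smooth, $2\pi$-periodic in $\theta$; $\rho_K,\psi_K$ being $2\pi\varkappa$-periodic in $\zeta$ with zero mean over $\zeta$) are the uniquely determined ones such that, with $R_\infty=r+\sum_{K\ge0}\tau^{-\frac{M+K}N}\rho_K$, $\Psi_\infty=\theta+\sum_{K\ge0}\tau^{-\frac{M+K}N}\psi_K$, one has, as formal series in powers of $\tau^{-1/N}$ (right-hand sides Taylor-expanded about $(r,\theta)$), $$\Big(\tau^{-\frac MN}(\mathcal A\partial_r+\mathcal B\partial_\theta)+\partial_\tau+\vartheta\partial_\zeta\Big)\begin{pmatrix}R_\infty\\ \Psi_\infty\end{pmatrix}=\sum_{K\ge0}\tau^{-\frac{M+K}N}\begin{pmatrix}\Lambda_K(R_\infty,\Psi_\infty)\\ \Omega_K(R_\infty,\Psi_\infty)\end{pmatrix}.$$ In the claim these functions are evaluated at $(\varrho,\varphi)$ in place of $(r,\theta)$;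 the truncated system is considered for $\tau>\tau_0$ with some $\tau_0>0$. *)

theory Defs
  imports "HOL-Analysis.Analysis"
begin

(* Meaningful for open S only: derivatives are taken at x, not within S. *)

fun higher_differentiable_on ::
    "'a::real_normed_vector set \<Rightarrow> ('a \<Rightarrow> 'b::real_normed_vector) \<Rightarrow> nat \<Rightarrow> bool" where
  "higher_differentiable_on S f 0 \<longleftrightarrow> continuous_on S f"
| "higher_differentiable_on S f (Suc n) \<longleftrightarrow>
     (\<forall>x\<in>S. f differentiable (at x)) \<and>
     (\<forall>v. higher_differentiable_on S (\<lambda>x. frechet_derivative f (at x) v) n)"

definition smooth_on ::
    "'a::real_normed_vector set \<Rightarrow> ('a \<Rightarrow> 'b::real_normed_vector) \<Rightarrow> bool" where
  "smooth_on S f \<longleftrightarrow> (\<forall>n. higher_differentiable_on S f n)"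

(* F(z, w) ~ sum_k z^(e k) c_k(w) as z tends to infinity, uniformly for w in W; the series need
   not converge.  The exponents e k are decreasing in all uses. *)

definition uniform_expansion ::
    "'w set \<Rightarrow> (real \<Rightarrow> 'w \<Rightarrow> real) \<Rightarrow> (nat \<Rightarrow> real) \<Rightarrow> (nat \<Rightarrow> 'w \<Rightarrow> real) \<Rightarrow> bool" where
  "uniform_expansion W F e c \<longleftrightarrow>
     (\<forall>n. \<exists>C z0. \<forall>z\<ge>z0. \<forall>w\<in>W.
        \<bar>F z w - (\<Sum>k<n. z powr e k * c k w)\<bar> \<le> C * z powr e n)"


definition potential :: "nat \<Rightarrow> (nat \<Rightarrow> real) \<Rightarrow> real \<Rightarrow> real" where
  "potential h u x = x ^ (2 * h) / real (2 * h) + (\<Sum>i = 1..2 * h - 1. u i * x ^ i)"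

definition hamiltonian :: "nat \<Rightarrow> (nat \<Rightarrow> real) \<Rightarrow> real \<Rightarrow> real \<Rightarrow> real" where
  "hamiltonian h u x y = y ^ 2 / 2 + potential h u x"

(* The perturbation f ~ sum_k t^(-k/q) f_k with
   f_k = sum over i <= p and j < m of A_{k,i,j}(S) x^i y^j.
   Used with m = l for f and with m = l + 1 for g. *)

definition admissible_perturbation ::
    "nat \<Rightarrow> nat \<Rightarrow> nat \<Rightarrow> (real \<Rightarrow> real \<Rightarrow> real \<Rightarrow> real \<Rightarrow> real) \<Rightarrow>
     (nat \<Rightarrow> nat \<Rightarrow> nat \<Rightarrow> real \<Rightarrow> real) \<Rightarrow> bool" where
  "admissible_perturbation q p m f A \<longleftrightarrow>
     smooth_on (UNIV \<times> UNIV \<times> UNIV \<times> {0<..}) (\<lambda>(x, y, S, t). f x y S t) \<and>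
     (\<forall>x y S t. 0 < t \<longrightarrow> f x y (S + 2 * pi) t = f x y S t) \<and>
     (\<forall>k S. \<forall>i\<le>p. \<forall>j<m. A k i j (S + 2 * pi) = A k i j S) \<and>
     (\<forall>k S. \<forall>i\<le>p. \<forall>j<m. p < i + j \<longrightarrow> A k i j S = 0) \<and>
     (\<forall>R. uniform_expansion ({-R..R} \<times> {-R..R} \<times> UNIV) (\<lambda>t (x, y, S). f x y S t)
        (\<lambda>k. - (real k / real q))
        (\<lambda>k (x, y, S). \<Sum>i\<le>p. \<Sum>j<m. A k i j S * x ^ i * y ^ j))"

definition closed_regular_levels :: "nat \<Rightarrow> (nat \<Rightarrow> real) \<Rightarrow> real \<Rightarrow> bool" where
  "closed_regular_levels h u E0 \<longleftrightarrow>
     (\<forall>E>E0.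
        (\<exists>c :: real \<Rightarrow> real \<times> real. simple_path c \<and> pathfinish c = pathstart c \<and>
           path_image c = {(x, y). hamiltonian h u x y = E}) \<and>
        (\<forall>x y. hamiltonian h u x y = E \<longrightarrow>
           \<not> (deriv (\<lambda>y. hamiltonian h u x y) y = 0 \<and> deriv (\<lambda>x. hamiltonian h u x y) x = 0)))"

(* (x0 t E, y0 t E) is the solution on the level H = E, with least period T E. *)

definition periodic_family ::
    "nat \<Rightarrow> (nat \<Rightarrow> real) \<Rightarrow> real \<Rightarrow> (real \<Rightarrow> real \<Rightarrow> real) \<Rightarrow> (real \<Rightarrow> real \<Rightarrow> real) \<Rightarrow>
     (real \<Rightarrow> real) \<Rightarrow> bool" where
  "periodic_family h u E0 x0 y0 T \<longleftrightarrow>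
     smooth_on (UNIV \<times> {E0<..}) (\<lambda>(t, E). x0 t E) \<and>
     smooth_on (UNIV \<times> {E0<..}) (\<lambda>(t, E). y0 t E) \<and>
     (\<forall>E>E0.
        (\<forall>t. hamiltonian h u (x0 t E) (y0 t E) = E \<and>
           ((\<lambda>t. x0 t E) has_real_derivative
              deriv (\<lambda>y. hamiltonian h u (x0 t E) y) (y0 t E)) (at t) \<and>
           ((\<lambda>t. y0 t E) has_real_derivative
              - deriv (\<lambda>x. hamiltonian h u x (y0 t E)) (x0 t E)) (at t)) \<and>
        0 < T E \<and>
        (\<forall>t. x0 (t + T E) E = x0 t E \<and> y0 (t + T E) E = y0 t E) \<and>
        (\<forall>P. 0 < P \<and> P < T E \<longrightarrow>
           \<not> (\<forall>t. x0 (t + P) E = x0 t E \<and> y0 (t + P) E = y0 t E)))"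


(* Formal series in eps = tau^(-1/N) whose coefficients are functions of (r, theta, zeta)
   are represented as functions of (r, theta, zeta) with values in real fps (fps_X is eps). *)

type_synonym formal_series = "real \<Rightarrow> real \<Rightarrow> real \<Rightarrow> real fps"

definition formal_deriv_r :: "formal_series \<Rightarrow> formal_series" where
  "formal_deriv_r Z r \<theta> \<zeta> = Abs_fps (\<lambda>n. deriv (\<lambda>r. fps_nth (Z r \<theta> \<zeta>) n) r)"

definition formal_deriv_\<theta> :: "formal_series \<Rightarrow> formal_series" where
  "formal_deriv_\<theta> Z r \<theta> \<zeta> = Abs_fps (\<lambda>n. deriv (\<lambda>\<theta>. fps_nth (Z r \<theta> \<zeta>) n) \<theta>)"

definition formal_deriv_\<zeta> :: "formal_series \<Rightarrow> formal_series" where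
  "formal_deriv_\<zeta> Z r \<theta> \<zeta> = Abs_fps (\<lambda>n. deriv (\<lambda>\<zeta>. fps_nth (Z r \<theta> \<zeta>) n) \<zeta>)"

(* d/dtau = - (1/N) eps^(N+1) d/deps, since eps = tau^(-1/N). *)

definition formal_deriv_\<tau> :: "nat \<Rightarrow> formal_series \<Rightarrow> formal_series" where
  "formal_deriv_\<tau> N Z r \<theta> \<zeta> =
     - (fps_const (1 / real N) * fps_X ^ (N + 1) * fps_deriv (Z r \<theta> \<zeta>))"

definition formal_transport ::
    "nat \<Rightarrow> nat \<Rightarrow> real \<Rightarrow> (nat \<Rightarrow> real \<Rightarrow> real \<Rightarrow> real \<Rightarrow> real) \<Rightarrow>
     (nat \<Rightarrow> real \<Rightarrow> real \<Rightarrow> real \<Rightarrow> real) \<Rightarrow> formal_series \<Rightarrow> formal_series" where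
  "formal_transport M N vtheta AK BK Z r \<theta> \<zeta> =
     fps_X ^ M * (Abs_fps (\<lambda>K. AK K r \<theta> \<zeta>) * formal_deriv_r Z r \<theta> \<zeta> +
                  Abs_fps (\<lambda>K. BK K r \<theta> \<zeta>) * formal_deriv_\<theta> Z r \<theta> \<zeta>) +
     formal_deriv_\<tau> N Z r \<theta> \<zeta> + fps_const vtheta * formal_deriv_\<zeta> Z r \<theta> \<zeta>"

(* The Taylor series of P about (r, theta), evaluated at (r + d1, theta + d2) for formal series
   d1, d2 without constant term: then d1^i d2^j has no coefficient of index below i + j, so that
   the finite sum below is the full coefficient of index n. *)

definition formal_taylor ::
    "(real \<Rightarrow> real \<Rightarrow> real) \<Rightarrow> real \<Rightarrow> real \<Rightarrow> real fps \<Rightarrow> real fps \<Rightarrow> real fps" where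
  "formal_taylor P r \<theta> d1 d2 = Abs_fps (\<lambda>n. \<Sum>i\<le>n. \<Sum>j\<le>n - i.
     (deriv ^^ i) (\<lambda>r. (deriv ^^ j) (\<lambda>\<theta>. P r \<theta>) \<theta>) r / (fact i * fact j) *
     fps_nth (d1 ^ i * d2 ^ j) n)"

(* The infinite sums over K are taken in the metric of real fps, i.e. coefficientwise. *)

definition averaging_identity ::
    "nat \<Rightarrow> nat \<Rightarrow> real \<Rightarrow> (nat \<Rightarrow> real \<Rightarrow> real \<Rightarrow> real \<Rightarrow> real) \<Rightarrow>
     (nat \<Rightarrow> real \<Rightarrow> real \<Rightarrow> real \<Rightarrow> real) \<Rightarrow> (nat \<Rightarrow> real \<Rightarrow> real \<Rightarrow> real) \<Rightarrow>
     (nat \<Rightarrow> real \<Rightarrow> real \<Rightarrow> real) \<Rightarrow> (nat \<Rightarrow> real \<Rightarrow> real \<Rightarrow> real \<Rightarrow> real) \<Rightarrow>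
     (nat \<Rightarrow> real \<Rightarrow> real \<Rightarrow> real \<Rightarrow> real) \<Rightarrow> bool" where
  "averaging_identity M N vtheta AK BK \<Lambda> \<Omega> \<rho> \<psi> \<longleftrightarrow>
     (let dR = (\<lambda>r \<theta> \<zeta>. fps_X ^ M * Abs_fps (\<lambda>K. \<rho> K r \<theta> \<zeta>));
          dPsi = (\<lambda>r \<theta> \<zeta>. fps_X ^ M * Abs_fps (\<lambda>K. \<psi> K r \<theta> \<zeta>));
          R = (\<lambda>r \<theta> \<zeta>. fps_const r + dR r \<theta> \<zeta>);
          Psi = (\<lambda>r \<theta> \<zeta>. fps_const \<theta> + dPsi r \<theta> \<zeta>)
      in \<forall>r \<theta> \<zeta>.
        (\<lambda>K. fps_X ^ (M + K) * formal_taylor (\<Lambda> K) r \<theta> (dR r \<theta> \<zeta>) (dPsi r \<theta> \<zeta>))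
          sums formal_transport M N vtheta AK BK R r \<theta> \<zeta> \<and>
        (\<lambda>K. fps_X ^ (M + K) * formal_taylor (\<Omega> K) r \<theta> (dR r \<theta> \<zeta>) (dPsi r \<theta> \<zeta>))
          sums formal_transport M N vtheta AK BK Psi r \<theta> \<zeta>)"


definition truncated_solution ::
    "nat \<Rightarrow> nat \<Rightarrow> nat \<Rightarrow> nat \<Rightarrow> (nat \<Rightarrow> real \<Rightarrow> real \<Rightarrow> real) \<Rightarrow> (nat \<Rightarrow> real \<Rightarrow> real \<Rightarrow> real) \<Rightarrow>
     real set \<Rightarrow> (real \<Rightarrow> real) \<Rightarrow> (real \<Rightarrow> real) \<Rightarrow> bool" where
  "truncated_solution M N L n \<Lambda> \<Omega> J v \<phi> \<longleftrightarrow>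
     (\<forall>\<tau>\<in>J.
        (v has_real_derivative
           (\<Sum>K = L..n. \<tau> powr (- (real (M + K) / real N)) * \<Lambda> K (v \<tau>) (\<phi> \<tau>))) (at \<tau> within J) \<and>
        (\<phi> has_real_derivative
           (\<Sum>K = 0..n. \<tau> powr (- (real (M + K) / real N)) * \<Omega> K (v \<tau>) (\<phi> \<tau>))) (at \<tau> within J))"

(* A solution starting at time ts that cannot be continued to the right. *)

definition maximal_truncated_solution ::
    "nat \<Rightarrow> nat \<Rightarrow> nat \<Rightarrow> nat \<Rightarrow> (nat \<Rightarrow> real \<Rightarrow> real \<Rightarrow> real) \<Rightarrow> (nat \<Rightarrow> real \<Rightarrow> real \<Rightarrow> real) \<Rightarrow>
     real \<Rightarrow> real set \<Rightarrow> (real \<Rightarrow> real) \<Rightarrow> (real \<Rightarrow> real) \<Rightarrow> bool" where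
  "maximal_truncated_solution M N L n \<Lambda> \<Omega> ts J v \<phi> \<longleftrightarrow>
     is_interval J \<and> ts \<in> J \<and> J \<subseteq> {ts..} \<and> truncated_solution M N L n \<Lambda> \<Omega> J v \<phi> \<and>
     \<not> (\<exists>J' v' \<phi>'. is_interval J' \<and> J \<subset> J' \<and> J' \<subseteq> {ts..} \<and>
          truncated_solution M N L n \<Lambda> \<Omega> J' v' \<phi>' \<and>
          (\<forall>\<tau>\<in>J. v' \<tau> = v \<tau> \<and> \<phi>' \<tau> = \<phi> \<tau>))"

end

(* The leading drift \<Lambda>_L has a fixed sign and its time factor tau^(-(M+L)/N) decays no faster than
   1/tau because M + L <= N.  On a bounded domain \<Lambda>_L is bounded away from 0 and the later terms are
   of lower order, so a solution defined for all times and confined to the domain would drift at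
   least logarithmically, which is absurd.  A confined solution with a finite time of existence, on
   the other hand, can be continued (Picard-Lindeloef), against maximality. *)

theory Submission
  imports Defs
begin

text \<open>Maximality is stated as the absence of a proper extension, not as blow-up. Confinement
  on a finite time interval therefore has to be refuted by constructing a longer solution, and the
  construction depends on whether the right endpoint belongs to the interval. The drift estimate
  involves \<open>v\<close> alone; \<open>\<phi>\<close> enters only as a coordinate of a point in a
  compact set. The closure of the domain supplies this compact set, and so one positive lower bound
  for the leading coefficient and finite bounds for all later ones. The later terms are dominated
  only after a time that depends on the domain and on \<open>n\<close>. As the argument concerns
  solutions on a whole half line, no uniformity in \<open>n\<close> is involved, and the threshold
  for \<open>n\<close> can be taken to be \<open>L\<close>.\<close>

section \<open>Lipschitz bounds from smoothness\<close>

lemma smooth_on_continuous_on: "smooth_on S f \<Longrightarrow> continuous_on S f"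
  unfolding smooth_on_def by (metis higher_differentiable_on.simps(1))

text \<open>\<open>higher_differentiable_on\<close> makes each directional derivative continuous,
  but says nothing directly about the operator norm. In finite dimension the norm is controlled by
  the values on the basis vectors, each bounded on the compact set, and the mean value inequality on
  a convex set does the rest.\<close>

lemma smooth_on_UNIV_lipschitz_on:
  fixes f :: "'a::euclidean_space \<Rightarrow> 'b::real_normed_vector"
  assumes "smooth_on UNIV f" "compact K" "convex K"
  obtains C where "C-lipschitz_on K f"
proof -
  define D where "D = (\<lambda>x. frechet_derivative f (at x))"
  from assms(1) have "higher_differentiable_on UNIV f (Suc 0)"
    unfolding smooth_on_def by blast
  then have df: "(f has_derivative D x) (at x)" and cont: "continuous_on UNIV (\<lambda>x. D x v)" for x v
    by (auto simp: D_def frechet_derivative_works[symmetric])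
  have "\<exists>C. \<forall>x\<in>K. norm (D x v) \<le> C" for v
    using compact_imp_bounded[OF compact_continuous_image[OF continuous_on_subset[OF cont[of v] subset_UNIV] assms(2)]]
    by (auto simp: bounded_iff)
  then obtain C where C: "\<And>v x. x \<in> K \<Longrightarrow> norm (D x v) \<le> C v"
    by metis
  define B where "B = (\<Sum>b\<in>Basis. \<bar>C b\<bar>)"
  have "onorm (D x) \<le> B" if "x \<in> K" for x
  proof (rule onorm_le)
    fix v :: 'a
    interpret bounded_linear "D x"
      using df by (rule has_derivative_bounded_linear)
    have "D x v = (\<Sum>b\<in>Basis. (v \<bullet> b) *\<^sub>R D x b)"
      by (subst euclidean_representation[of v, symmetric]) (simp only: sum scaleR)
    also have "norm \<dots> \<le> (\<Sum>b\<in>Basis. norm v * \<bar>C b\<bar>)"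
    proof (rule sum_norm_le)
      fix b :: 'a assume "b \<in> Basis"
      then show "norm ((v \<bullet> b) *\<^sub>R D x b) \<le> norm v * \<bar>C b\<bar>"
        using C[OF that, of b] Basis_le_norm[of b v] by (auto intro!: mult_mono)
    qed
    finally show "norm (D x v) \<le> B * norm v"
      by (simp add: B_def sum_distrib_left mult.commute)
  qed
  moreover have "0 \<le> B"
    by (simp add: B_def sum_nonneg)
  ultimately have "B-lipschitz_on K f"
    by (intro bounded_derivative_imp_lipschitz[OF has_derivative_at_withinI[OF df] assms(3)])
  then show ?thesis ..
qed

section \<open>Existence of solutions by the Banach fixed point theorem\<close>

text \<open>The integral operator contracts the supremum metric by the factor \<open>C * e\<close>.
  Its fixed point satisfies the integral equation, and differentiating that equation gives the ODE,
  one-sided at the endpoints.\<close>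

lemma picard_lindeloef_global:
  fixes f :: "real \<Rightarrow> 'a::banach \<Rightarrow> 'a"
  assumes e: "0 \<le> e" "C * e < 1"
    and cont: "continuous_on ({T..T + e} \<times> UNIV) (\<lambda>(t, z). f t z)"
    and lip: "\<And>t. t \<in> {T..T + e} \<Longrightarrow> C-lipschitz_on UNIV (f t)"
  obtains z where "z T = z0"
    "\<And>t. t \<in> {T..T + e} \<Longrightarrow> (z has_vector_derivative f t (z t)) (at t within {T..T + e})"
proof -
  have C0: "0 \<le> C"
    using lip[of T] e by (auto intro: lipschitz_on_nonneg)
  define J where "J = (\<lambda>g t. z0 + integral {T..t} (\<lambda>s. f s (g s)))"
  \<comment> \<open>\<open>clamp\<close> freezes \<open>J g\<close> outside the time interval. The
    iterates thus become bounded continuous functions on the whole line, a complete metric space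
    given by a type, as \<open>banach_fix_type\<close> requires.\<close>
  define P where "P = (\<lambda>g :: real \<Rightarrow>\<^sub>C 'a. Bcontfun (\<lambda>t. J g (clamp T (T + e) t)))"
  have cf: "continuous_on {T..T + e} (\<lambda>s. f s (g s))" if "continuous_on UNIV g" for g
    by (rule continuous_on_compose2[OF cont, of _ "\<lambda>s. (s, g s)", simplified])
      (auto intro!: continuous_intros continuous_on_subset[OF that])
  have intf: "(\<lambda>s. f s (g s)) integrable_on {T..t}" if "continuous_on UNIV g" "t \<le> T + e" for g t
    by (rule integrable_continuous_real, rule continuous_on_subset[OF cf[OF that(1)]]) (use that in auto)
  have cJ: "continuous_on (cbox T (T + e)) (J g)" if "continuous_on UNIV g" for g
    unfolding J_def
    by (auto intro!: continuous_intros indefinite_integral_continuous_1 intf[OF that])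
  have "(\<lambda>t. J g (clamp T (T + e) t)) \<in> bcontfun" if "continuous_on UNIV g" for g
    unfolding bcontfun_def
    using clamp_continuous_on[OF cJ[OF that]]
      clamp_bounded[OF compact_imp_bounded[OF compact_continuous_image[OF cJ[OF that] compact_cbox]]]
    by simp
  then have PJ: "P g t = J g (clamp T (T + e) t)" for g t
    unfolding P_def by (subst Bcontfun_inverse) auto
  have "dist (P g) (P k) \<le> (C * e) * dist g k" for g k
  proof (rule dist_bound)
    fix t
    define c where "c = clamp T (T + e) t"
    have c: "T \<le> c" "c \<le> T + e"
      using clamp_in_interval[of T "T + e" t] e by (auto simp: c_def)
    have "dist (P g t) (P k t) = norm (integral {T..c} (\<lambda>s. f s (g s) - f s (k s)))"
      unfolding PJ c_def[symmetric] J_def dist_norm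
      by (subst Henstock_Kurzweil_Integration.integral_diff) (auto intro!: intf c)
    also have "\<dots> \<le> (C * dist g k) * (c - T)"
    proof (rule integral_bound)
      show "continuous_on {T..c} (\<lambda>s. f s (g s) - f s (k s))"
        by (intro continuous_intros continuous_on_subset[OF cf]) (use c in auto)
      fix s assume "s \<in> {T..c}"
      then have "dist (f s (g s)) (f s (k s)) \<le> C * dist (g s) (k s)"
        using c by (intro lipschitz_onD[OF lip]) auto
      also have "\<dots> \<le> C * dist g k"
        by (intro mult_left_mono dist_bounded C0)
      finally show "norm (f s (g s) - f s (k s)) \<le> C * dist g k"
        by (simp add: dist_norm)
    qed (use c in auto)
    also have "\<dots> \<le> (C * dist g k) * e"
      using c C0 by (intro mult_left_mono) auto
    finally show "dist (P g t) (P k t) \<le> (C * e) * dist g k"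
      by (simp add: mult_ac)
  qed
  then obtain g where g: "P g = g"
    using banach_fix_type[of "C * e" P] e C0 by auto
  have gJ: "g t = J g t" if "t \<in> {T..T + e}" for t
    using PJ[of g t] that by (simp add: g)
  show ?thesis
  proof
    show "apply_bcontfun g T = z0"
      using gJ[of T] e by (simp add: J_def)
    fix t assume t: "t \<in> {T..T + e}"
    have "(J g has_vector_derivative f t (g t)) (at t within {T..T + e})"
      unfolding J_def
      by (rule has_vector_derivative_eq_rhs, rule has_vector_derivative_add, rule has_vector_derivative_const,
          rule integral_has_vector_derivative[OF cf t]) auto
    with t gJ show "(apply_bcontfun g has_vector_derivative f t (g t)) (at t within {T..T + e})"
      by (auto intro: has_vector_derivative_transform)
  qed
qed

text \<open>Precomposing the field with the closest-point projection onto the ball makes it globally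
  Lipschitz with the same constant, because the projection is nonexpansive. For a short time the
  solution of the modified equation stays in the ball, where the projection is the identity.\<close>

lemma picard_lindeloef_local:
  fixes f :: "real \<Rightarrow> 'a::euclidean_space \<Rightarrow> 'a"
  assumes cont: "continuous_on ({T..T + 1} \<times> cball z0 1) (\<lambda>(t, z). f t z)"
    and lip: "\<And>t. t \<in> {T..T + 1} \<Longrightarrow> C-lipschitz_on (cball z0 1) (f t)"
  obtains e z where "0 < e" "z T = z0"
    "\<And>t. t \<in> {T..T + e} \<Longrightarrow> (z has_vector_derivative f t (z t)) (at t within {T..T + e})"
proof -
  define \<pi> where "\<pi> = closest_point (cball z0 1)"
  have \<pi>: "\<pi> x \<in> cball z0 1" for x
    unfolding \<pi>_def by (rule closest_point_in_set) auto
  have \<pi>_lip: "1-lipschitz_on UNIV \<pi>"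
    unfolding \<pi>_def by (intro lipschitz_onI) (use closest_point_lipschitz[of "cball z0 1"] in auto)
  have C0: "0 \<le> C"
    using lip[of T] by (auto intro: lipschitz_on_nonneg)
  obtain B where B: "\<And>t z. t \<in> {T..T + 1} \<Longrightarrow> z \<in> cball z0 1 \<Longrightarrow> norm (f t z) \<le> B"
    using compact_imp_bounded[OF compact_continuous_image[OF cont compact_Times[OF compact_Icc compact_cball]]]
    by (fastforce simp: bounded_iff)
  have B0: "0 \<le> B"
    using order_trans[OF norm_ge_zero B[of T z0]] by auto
  \<comment> \<open>Three demands on the step length: \<open>C * e < 1\<close> for the contraction,
    \<open>B * e \<le> 1\<close> to remain in the unit ball, and \<open>e \<le> 1\<close> to remain
    in the time range of the hypotheses.\<close>
  define e where "e = 1 / (1 + B + C)"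
  have e: "0 < e" "e \<le> 1" "C * e < 1" "B * e \<le> 1"
    using B0 C0 by (auto simp: e_def field_simps)
  have "continuous_on ({T..T + e} \<times> UNIV) (\<lambda>p. f (fst p) (\<pi> (snd p)))"
    by (rule continuous_on_compose2[OF cont, of _ "\<lambda>p. (fst p, \<pi> (snd p))", simplified])
      (use e \<pi> in \<open>auto intro!: continuous_intros
          continuous_on_compose2[OF lipschitz_on_continuous_on[OF \<pi>_lip]]\<close>)
  then have "continuous_on ({T..T + e} \<times> UNIV) (\<lambda>(t, z). f t (\<pi> z))"
    by (simp add: case_prod_beta)
  moreover have "C-lipschitz_on UNIV (\<lambda>z. f t (\<pi> z))" if "t \<in> {T..T + e}" for t
    using lipschitz_on_compose2[OF \<pi>_lip lipschitz_on_subset[OF lip], of t] \<pi> that e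
    by (auto simp: image_subset_iff)
  ultimately obtain z where z0: "z T = z0" and
    z: "\<And>t. t \<in> {T..T + e} \<Longrightarrow> (z has_vector_derivative f t (\<pi> (z t))) (at t within {T..T + e})"
    using picard_lindeloef_global[of e C T "\<lambda>t z. f t (\<pi> z)" z0] e by auto
  \<comment> \<open>The speed bound \<open>B\<close> holds before it is known that \<open>z\<close>
    stays in the ball, since the field is only evaluated at projected points. No first-exit-time
    argument is required.\<close>
  have "\<pi> (z t) = z t" if t: "t \<in> {T..T + e}" for t
  proof -
    have "norm (z t - z T) \<le> B * norm (t - T)"
    proof (rule differentiable_bound[OF _ z[unfolded has_vector_derivative_def]])
      fix s assume "s \<in> {T..T + e}"
      then show "onorm (\<lambda>h. h *\<^sub>R f s (\<pi> (z s))) \<le> B"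
        using B[of s "\<pi> (z s)"] \<pi> e
        by (subst onorm_scaleR_left) (auto simp: onorm_id bounded_linear_ident)
    qed (use t e in auto)
    also have "\<dots> \<le> B * e"
      using t B0 by (intro mult_left_mono) auto
    finally have "z t \<in> cball z0 1"
      using e z0 by (simp add: dist_norm norm_minus_commute)
    then show ?thesis
      unfolding \<pi>_def by (rule closest_point_self)
  qed
  with z z0 e(1) show ?thesis
    by (intro that[of e z]) auto
qed

section \<open>Continuation of bounded solutions\<close>

text \<open>Taking derivatives within \<open>J\<close> makes them one-sided at included endpoints,
  in agreement with \<open>truncated_solution\<close>.\<close>

definition ode_solution :: "(real \<Rightarrow> 'a::real_normed_vector \<Rightarrow> 'a) \<Rightarrow> real set \<Rightarrow> (real \<Rightarrow> 'a) \<Rightarrow> bool" where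
  "ode_solution f J z \<longleftrightarrow> (\<forall>t\<in>J. (z has_vector_derivative f t (z t)) (at t within J))"

text \<open>A local solution started at \<open>z T\<close> is glued on. At \<open>T\<close> the two
  pieces share their value, so both one-sided derivatives equal \<open>f T (z T)\<close> and the
  glued function is differentiable there.\<close>

lemma ode_solution_extend_right:
  fixes f :: "real \<Rightarrow> 'a::euclidean_space \<Rightarrow> 'a"
  assumes z: "ode_solution f {ts..T} z" and "ts \<le> T"
    and cont: "continuous_on ({T..T + 1} \<times> cball (z T) 1) (\<lambda>(t, z). f t z)"
    and lip: "\<And>t. t \<in> {T..T + 1} \<Longrightarrow> C-lipschitz_on (cball (z T) 1) (f t)"
  obtains e z' where "0 < e" "ode_solution f {ts..T + e} z'" "\<And>t. t \<in> {ts..T} \<Longrightarrow> z' t = z t"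
proof -
  obtain e w where e: "0 < e" and wT: "w T = z T" and
    w: "\<And>t. t \<in> {T..T + e} \<Longrightarrow> (w has_vector_derivative f t (w t)) (at t within {T..T + e})"
    using picard_lindeloef_local[OF cont lip] by metis
  define z' where "z' = (\<lambda>t. if t \<in> {ts..T} then z t else w t)"
  have cl: "closure {ts..T} \<inter> closure {T..T + e} = {T}"
    using e \<open>ts \<le> T\<close> by auto
  have "(z' has_vector_derivative (if t \<in> {ts..T} then f t (z t) else f t (w t))) (at t within {ts..T + e})"
    if "t \<in> {ts..T + e}" for t
    unfolding z'_def
  proof (rule has_vector_derivative_If_within_closures[where T = "{T..T + e}"], unfold cl)
    assume "t \<in> {ts..T} \<union> {T}"
    moreover have "{ts..T} \<union> {T} = {ts..T}"
      using \<open>ts \<le> T\<close> by auto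
    ultimately show "(z has_vector_derivative f t (z t)) (at t within {ts..T} \<union> {T})"
      using z unfolding ode_solution_def by metis
  next
    assume "t \<in> {T..T + e} \<union> {T}"
    moreover have "{T..T + e} \<union> {T} = {T..T + e}"
      using e by auto
    ultimately show "(w has_vector_derivative f t (w t)) (at t within {T..T + e} \<union> {T})"
      using w by metis
  next
    assume "t \<in> closure {ts..T}" "t \<in> closure {T..T + e}"
    then have "t = T" by auto
    then show "z t = w t" "f t (z t) = f t (w t)"
      using wT by auto
  qed (use that e \<open>ts \<le> T\<close> in auto)
  moreover have "(if t \<in> {ts..T} then f t (z t) else f t (w t)) = f t (z' t)" for t
    by (simp add: z'_def)
  ultimately have "ode_solution f {ts..T + e} z'"
    unfolding ode_solution_def by metis
  moreover have "z' t = z t" if "t \<in> {ts..T}" for t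
    using that by (simp add: z'_def)
  ultimately show ?thesis
    using e that by blast
qed

text \<open>Bounded speed makes \<open>z\<close> Lipschitz, which yields a limit at
  \<open>T\<close>. That the extended function also satisfies the equation at \<open>T\<close> comes
  from the integral form, whose integrand is continuous up to the endpoint.\<close>

lemma ode_solution_extend_endpoint:
  fixes f :: "real \<Rightarrow> 'a::euclidean_space \<Rightarrow> 'a"
  assumes z: "ode_solution f {ts..<T} z" and "ts < T"
    and K: "compact K" "z ` {ts..<T} \<subseteq> K"
    and cont: "continuous_on ({ts..T} \<times> K) (\<lambda>(t, z). f t z)"
  obtains z' where "ode_solution f {ts..T} z'" "\<And>t. t \<in> {ts..<T} \<Longrightarrow> z' t = z t"
proof -
  obtain B where B: "\<And>t z. t \<in> {ts..T} \<Longrightarrow> z \<in> K \<Longrightarrow> norm (f t z) \<le> B"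
    using compact_imp_bounded[OF compact_continuous_image[OF cont compact_Times[OF compact_Icc K(1)]]]
    by (fastforce simp: bounded_iff)
  have zK: "z t \<in> K" if "t \<in> {ts..<T}" for t
    using K(2) that by blast
  have "B-lipschitz_on {ts..<T} z"
  proof (rule bounded_derivative_imp_lipschitz)
    fix t assume t: "t \<in> {ts..<T}"
    show "(z has_derivative (\<lambda>h. h *\<^sub>R f t (z t))) (at t within {ts..<T})"
      using z t by (simp add: ode_solution_def has_vector_derivative_def)
    show "onorm (\<lambda>h. h *\<^sub>R f t (z t)) \<le> B"
      using B[OF _ zK] t
      by (subst onorm_scaleR_left) (auto simp: onorm_id bounded_linear_ident)
  next
    show "0 \<le> B"
      using order_trans[OF norm_ge_zero B[of ts "z ts"]] zK[of ts] \<open>ts < T\<close> by auto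
  qed auto
  then obtain g where g: "B-lipschitz_on (closure {ts..<T}) g" and gz: "\<And>t. t \<in> {ts..<T} \<Longrightarrow> g t = z t"
    using lipschitz_extend_closure by metis
  have cl: "closure {ts..<T} = {ts..T}"
    using \<open>ts < T\<close> by simp
  have cg: "continuous_on {ts..T} g"
    using lipschitz_on_continuous_on[OF g] cl by simp
  \<comment> \<open>Closedness of \<open>K\<close> puts the limit value into the set on which the
    field is assumed continuous.\<close>
  have "g ` closure {ts..<T} \<subseteq> K"
    using cg K gz by (intro image_closure_subset) (auto simp: compact_imp_closed cl)
  then have gK: "g ` {ts..T} \<subseteq> K"
    by (simp add: cl)
  have cf: "continuous_on {ts..T} (\<lambda>s. f s (g s))"
    by (rule continuous_on_compose2[OF cont, of _ "\<lambda>s. (s, g s)", simplified])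
      (use gK in \<open>auto intro!: continuous_intros cg\<close>)
  \<comment> \<open>The equation is known only at times before \<open>T\<close>; the fundamental
    theorem with interior derivatives and a continuous primitive still gives the integral equation
    up to and including \<open>T\<close>.\<close>
  have g_int: "g t = g ts + integral {ts..t} (\<lambda>s. f s (g s))" if t: "t \<in> {ts..T}" for t
  proof -
    have "((\<lambda>s. f s (g s)) has_integral (g t - g ts)) {ts..t}"
    proof (rule fundamental_theorem_of_calculus_interior)
      show "continuous_on {ts..t} g"
        using t by (auto intro: continuous_on_subset[OF cg])
      fix x assume x: "x \<in> {ts<..<t}"
      have "at x within {ts..<T} = at x"
        using x t by (intro at_within_interior) simp
      moreover have "x \<in> {ts..<T}"
        using x t by simp
      ultimately have "(z has_vector_derivative f x (g x)) (at x)"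
        using z gz[of x] unfolding ode_solution_def by metis
      then show "(g has_vector_derivative f x (g x)) (at x)"
      proof (rule has_vector_derivative_transform_within_open[OF _ open_greaterThanLessThan x])
        fix y assume "y \<in> {ts<..<t}"
        with t show "z y = g y"
          by (intro gz[symmetric]) auto
      qed
    qed (use t in auto)
    then show ?thesis
      by (simp add: integral_unique)
  qed
  have "(g has_vector_derivative f t (g t)) (at t within {ts..T})" if t: "t \<in> {ts..T}" for t
  proof (rule has_vector_derivative_transform[OF t g_int])
    show "((\<lambda>t. g ts + integral {ts..t} (\<lambda>s. f s (g s))) has_vector_derivative f t (g t)) (at t within {ts..T})"
      by (rule has_vector_derivative_eq_rhs, rule has_vector_derivative_add, rule has_vector_derivative_const,
          rule integral_has_vector_derivative[OF cf t]) auto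
  qed auto
  then show ?thesis
    using gz by (intro that[of g]) (auto simp: ode_solution_def)
qed

lemma half_line_interval_cases:
  fixes J :: "real set"
  assumes "is_interval J" "ts \<in> J" "J \<subseteq> {ts..}"
  obtains "J = {ts..}" | T where "ts \<le> T" "J = {ts..T}" | T where "ts < T" "J = {ts..<T}"
proof (cases "bdd_above J")
  case False
  have "t \<in> J" if "ts \<le> t" for t
  proof -
    obtain u where "u \<in> J" "t \<le> u"
      using False by (meson bdd_above.I linear)
    then show ?thesis
      using assms(1,2) that unfolding is_interval_1 by blast
  qed
  with assms(3) have "J = {ts..}" by auto
  then show ?thesis ..
next
  case True
  define T where "T = Sup J"
  have upper: "t \<le> T" if "t \<in> J" for t
    unfolding T_def using that True by (rule cSup_upper)
  have below: "t \<in> J" if "ts \<le> t" "t < T" for t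
  proof -
    have "t < Sup J" "J \<noteq> {}"
      using that assms(2) by (auto simp: T_def)
    then obtain u where "u \<in> J" "t < u"
      by (rule less_cSupE)
    then show ?thesis
      using assms(1,2) that unfolding is_interval_1 by (meson less_imp_le)
  qed
  show ?thesis
  proof (cases "T \<in> J")
    case True
    have "t \<in> J \<longleftrightarrow> t \<in> {ts..T}" for t
      using upper[of t] below[of t] assms(3) True by (cases "t = T") auto
    then have "J = {ts..T}" by blast
    then show ?thesis
      using that(2)[of T] upper[OF assms(2)] by simp
  next
    case False
    have "t \<in> J \<longleftrightarrow> t \<in> {ts..<T}" for t
      using upper[of t] below[of t] assms(3) False by (cases "t = T") auto
    then have "J = {ts..<T}" by blast
    then show ?thesis
      using that(3)[of T] assms(2) by auto
  qed
qed

text \<open>If \<open>J\<close> contains its right end, a new local solution is attached there. If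
  \<open>J\<close> is half-open, adjoining the endpoint alone already gives a proper extension;
  boundedness serves to obtain the limit value.\<close>

theorem bounded_solution_extends:
  fixes f :: "real \<Rightarrow> 'a::euclidean_space \<Rightarrow> 'a"
  assumes J: "is_interval J" "ts \<in> J" "J \<subseteq> {ts..}" "J \<noteq> {ts..}"
    and z: "ode_solution f J z" "bounded (z ` J)"
    and cont: "continuous_on ({ts..} \<times> UNIV) (\<lambda>(t, z). f t z)"
    and lip: "\<And>T z0. ts \<le> T \<Longrightarrow> \<exists>C. \<forall>t\<in>{T..T + 1}. C-lipschitz_on (cball z0 1) (f t)"
  obtains J' z' where "is_interval J'" "J \<subset> J'" "J' \<subseteq> {ts..}" "ode_solution f J' z'"
    "\<And>t. t \<in> J \<Longrightarrow> z' t = z t"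
  using J(1-3)
proof (cases rule: half_line_interval_cases)
  case 1
  then show ?thesis using J(4) by simp
next
  case (2 T)
  obtain C where C: "\<And>t. t \<in> {T..T + 1} \<Longrightarrow> C-lipschitz_on (cball (z T) 1) (f t)"
    using lip[OF 2(1)] by metis
  have "continuous_on ({T..T + 1} \<times> cball (z T) 1) (\<lambda>(t, z). f t z)"
    using 2 by (auto intro: continuous_on_subset[OF cont])
  then obtain e z' where "0 < e" "ode_solution f {ts..T + e} z'" "\<And>t. t \<in> {ts..T} \<Longrightarrow> z' t = z t"
    using ode_solution_extend_right[of f ts T z C] z(1) 2 C by metis
  then show ?thesis
    using 2 by (intro that[of "{ts..T + e}" z']) (auto simp: is_interval_cc)
next
  case (3 T)
  define K where "K = closure (z ` J)"
  have K: "compact K" "z ` {ts..<T} \<subseteq> K"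
    using z(2) 3 closure_subset[of "z ` J"] by (simp_all add: K_def)
  have "continuous_on ({ts..T} \<times> K) (\<lambda>(t, z). f t z)"
    by (auto intro: continuous_on_subset[OF cont])
  then obtain z' where "ode_solution f {ts..T} z'" "\<And>t. t \<in> {ts..<T} \<Longrightarrow> z' t = z t"
    using ode_solution_extend_endpoint[OF _ 3(1) K, of f] z(1) 3 by metis
  then show ?thesis
    using 3 by (intro that[of "{ts..T}" z']) (auto simp: is_interval_cc)
qed

section \<open>The truncated system as a planar ODE\<close>

definition truncated_field ::
    "nat \<Rightarrow> nat \<Rightarrow> nat \<Rightarrow> nat \<Rightarrow> (nat \<Rightarrow> real \<Rightarrow> real \<Rightarrow> real) \<Rightarrow> (nat \<Rightarrow> real \<Rightarrow> real \<Rightarrow> real) \<Rightarrow>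
     real \<Rightarrow> real \<times> real \<Rightarrow> real \<times> real" where
  "truncated_field M N L n \<Lambda> \<Omega> t z =
     (\<Sum>K = L..n. t powr (- (real (M + K) / real N)) * \<Lambda> K (fst z) (snd z),
      \<Sum>K = 0..n. t powr (- (real (M + K) / real N)) * \<Omega> K (fst z) (snd z))"

lemma truncated_solution_iff_ode_solution:
  "truncated_solution M N L n \<Lambda> \<Omega> J v \<phi> \<longleftrightarrow>
     ode_solution (truncated_field M N L n \<Lambda> \<Omega>) J (\<lambda>t. (v t, \<phi> t))"
proof -
  have "((\<lambda>t. (v t, \<phi> t)) has_vector_derivative (a, b)) (at t within J) \<longleftrightarrow>
      (v has_real_derivative a) (at t within J) \<and> (\<phi> has_real_derivative b) (at t within J)" for a b t
  proof
    assume "((\<lambda>t. (v t, \<phi> t)) has_vector_derivative (a, b)) (at t within J)"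
    from bounded_linear.has_vector_derivative[OF bounded_linear_fst this]
      bounded_linear.has_vector_derivative[OF bounded_linear_snd this]
    show "(v has_real_derivative a) (at t within J) \<and> (\<phi> has_real_derivative b) (at t within J)"
      by (simp add: has_real_derivative_iff_has_vector_derivative)
  qed (auto simp: has_real_derivative_iff_has_vector_derivative intro: has_vector_derivative_Pair)
  then show ?thesis
    by (simp add: truncated_solution_def ode_solution_def truncated_field_def)
qed

text \<open>The local existence lemma demands one constant valid for all times of the interval.
  Compactness of \<open>X\<close> bounds each weight by some \<open>W\<close>, so adding a term with
  Lipschitz constant \<open>D\<close> costs \<open>W * D\<close>.\<close>

lemma lipschitz_on_weighted_sum:
  fixes g :: "'k \<Rightarrow> 'a::metric_space \<Rightarrow> real" and w :: "'k \<Rightarrow> 't::topological_space \<Rightarrow> real"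
  assumes "finite A" "compact X" "\<And>k. continuous_on X (w k)" "\<And>k. \<exists>C. C-lipschitz_on U (g k)"
  shows "\<exists>C. \<forall>t\<in>X. C-lipschitz_on U (\<lambda>z. \<Sum>k\<in>A. w k t * g k z)"
  using assms(1)
proof induction
  case empty
  have "0-lipschitz_on U (\<lambda>z. 0 :: real)"
    by (intro lipschitz_onI) auto
  then show ?case by auto
next
  case (insert k A)
  obtain C where C: "\<forall>t\<in>X. C-lipschitz_on U (\<lambda>z. \<Sum>k\<in>A. w k t * g k z)"
    using insert.IH by blast
  obtain D where D: "D-lipschitz_on U (g k)"
    using assms(4) by blast
  obtain W where W: "\<And>t. t \<in> X \<Longrightarrow> \<bar>w k t\<bar> \<le> W"
    using compact_imp_bounded[OF compact_continuous_image[OF assms(3,2)], of k]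
    by (auto simp: bounded_iff)
  have "(W * D + C)-lipschitz_on U (\<lambda>z. w k t * g k z + (\<Sum>k\<in>A. w k t * g k z))" if "t \<in> X" for t
    using C that by (intro lipschitz_on_add lipschitz_on_cmult_real_upper D W) auto
  then show ?case
    using insert.hyps by auto
qed

lemma truncated_field_locally_lipschitz:
  assumes "\<And>K. smooth_on UNIV (\<lambda>(r, \<theta>). \<Lambda> K r \<theta>)" "\<And>K. smooth_on UNIV (\<lambda>(r, \<theta>). \<Omega> K r \<theta>)" "0 < T"
  shows "\<exists>C. \<forall>t\<in>{T..T + 1}. C-lipschitz_on (cball z0 1) (truncated_field M N L n \<Lambda> \<Omega> t)"
proof -
  have "\<exists>C. \<forall>t\<in>{T..T + 1}. C-lipschitz_on (cball z0 1)
      (\<lambda>z. \<Sum>K\<in>A. t powr (- (real (M + K) / real N)) * G K (fst z) (snd z))"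
    if A: "finite A" and G: "\<And>K. smooth_on UNIV (\<lambda>(r, \<theta>). G K r \<theta>)"
    for A and G :: "nat \<Rightarrow> real \<Rightarrow> real \<Rightarrow> real"
  proof (rule lipschitz_on_weighted_sum[OF A compact_Icc])
    show "continuous_on {T..T + 1} (\<lambda>t. t powr (- (real (M + K) / real N)))" for K
      using \<open>0 < T\<close> by (auto intro!: continuous_intros)
    show "\<exists>C. C-lipschitz_on (cball z0 1) (\<lambda>z. G K (fst z) (snd z))" for K
      by (rule smooth_on_UNIV_lipschitz_on[OF G[of K] compact_cball[of z0 1] convex_cball])
        (auto simp: case_prod_beta)
  qed
  note sum_lip = this
  obtain C where "\<forall>t\<in>{T..T + 1}. C-lipschitz_on (cball z0 1)
      (\<lambda>z. \<Sum>K = L..n. t powr (- (real (M + K) / real N)) * \<Lambda> K (fst z) (snd z))"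
    using sum_lip[where G = \<Lambda>, OF finite_atLeastAtMost assms(1)] by blast
  moreover obtain D where "\<forall>t\<in>{T..T + 1}. D-lipschitz_on (cball z0 1)
      (\<lambda>z. \<Sum>K = 0..n. t powr (- (real (M + K) / real N)) * \<Omega> K (fst z) (snd z))"
    using sum_lip[where G = \<Omega>, OF finite_atLeastAtMost assms(2)] by blast
  ultimately show ?thesis
    unfolding truncated_field_def
    by (intro exI[of _ "sqrt (C\<^sup>2 + D\<^sup>2)"]) (auto intro!: lipschitz_on_Pair)
qed

lemma continuous_on_truncated_field:
  assumes "\<And>K. smooth_on UNIV (\<lambda>(r, \<theta>). \<Lambda> K r \<theta>)" "\<And>K. smooth_on UNIV (\<lambda>(r, \<theta>). \<Omega> K r \<theta>)" "0 < ts"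
  shows "continuous_on ({ts..} \<times> UNIV) (\<lambda>(t, z). truncated_field M N L n \<Lambda> \<Omega> t z)"
proof -
  have *: "continuous_on S (\<lambda>p. G K (fst (snd p)) (snd (snd p)))"
    if "\<And>K. smooth_on UNIV (\<lambda>(r, \<theta>). G K r \<theta>)"
    for G :: "nat \<Rightarrow> real \<Rightarrow> real \<Rightarrow> real" and K and S :: "(real \<times> real \<times> real) set"
    using continuous_on_compose2[OF smooth_on_continuous_on[OF that[of K]] continuous_on_snd[OF continuous_on_id], of S]
    by (simp add: case_prod_beta)
  show ?thesis
    unfolding truncated_field_def case_prod_beta
    by (intro continuous_intros *[OF assms(1)] *[OF assms(2)]) (use \<open>0 < ts\<close> in auto)
qed

section \<open>The drift estimate\<close>

text \<open>The range is an interval that misses 0. Encoding the sign as a factor \<open>sg\<close>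
  of modulus 1 lets a single estimate cover upward and downward drift.\<close>

lemma nonvanishing_has_sign:
  fixes g :: "'a::real_normed_vector \<Rightarrow> real"
  assumes "continuous_on UNIV g" "\<And>x. g x \<noteq> 0"
  obtains sg where "\<bar>sg\<bar> = 1" "\<And>x. 0 < sg * g x"
proof -
  have I: "is_interval (range g)"
    using connected_continuous_image[OF assms(1) connected_UNIV] by (simp add: is_interval_connected_1)
  have "0 < g x \<longleftrightarrow> 0 < g y" for x y
  proof (rule ccontr)
    assume "(0 < g x) \<noteq> (0 < g y)"
    then have "g x \<le> 0 \<and> 0 \<le> g y \<or> g y \<le> 0 \<and> 0 \<le> g x"
      by auto
    then have "0 \<in> range g"
      using I unfolding is_interval_1 by blast
    with assms(2) show False
      by (metis imageE)
  qed
  then have "(\<forall>x. 0 < g x) \<or> (\<forall>x. g x < 0)"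
    using assms(2) by (metis linorder_neqE)
  then show ?thesis
    using that[of 1] that[of "-1"] by auto
qed

text \<open>From some time on, \<open>sg * v\<close> grows at least as fast as a positive multiple
  of \<open>ln t\<close>: the smallest leading coefficient on \<open>K\<close> is positive, and half
  of it is enough to absorb all later terms.\<close>

lemma sign_definite_drift_unbounded:
  fixes P :: "nat \<Rightarrow> 'a::metric_space \<Rightarrow> real" and v :: "real \<Rightarrow> real"
  assumes K: "compact K" and zK: "\<And>t. ts \<le> t \<Longrightarrow> z t \<in> K"
    and P: "\<And>k. continuous_on K (P k)" and sg: "\<bar>sg\<bar> = 1" "\<And>x. x \<in> K \<Longrightarrow> 0 < sg * P L x"
    and exps: "0 < N" "M + L \<le> N" "L \<le> n"
    and v: "\<And>t. ts \<le> t \<Longrightarrow> (v has_real_derivative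
        (\<Sum>k = L..n. t powr (- (real (M + k) / real N)) * P k (z t))) (at t within {ts..})"
  shows "\<not> bounded (v ` {ts..})"
proof
  assume "bounded (v ` {ts..})"
  then obtain B where B: "\<And>t. ts \<le> t \<Longrightarrow> \<bar>v t\<bar> \<le> B"
    by (auto simp: bounded_iff)
  define e where "e = (\<lambda>k. - (real (M + k) / real N))"
  define v' where "v' = (\<lambda>t. \<Sum>k = L..n. t powr e k * P k (z t))"
  have "K \<noteq> {}"
    using zK[of ts] by auto
  moreover have "continuous_on K (\<lambda>x. sg * P L x)"
    by (intro continuous_intros P)
  ultimately obtain x0 where x0: "x0 \<in> K" "\<And>x. x \<in> K \<Longrightarrow> sg * P L x0 \<le> sg * P L x"
    using continuous_attains_inf[OF K] by metis
  define c where "c = sg * P L x0"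
  have c: "0 < c"
    unfolding c_def by (rule sg(2)[OF x0(1)])
  have "\<exists>C. \<forall>x\<in>K. \<bar>P k x\<bar> \<le> C" for k
    using compact_imp_bounded[OF compact_continuous_image[OF P K], of k] by (auto simp: bounded_iff)
  then obtain C where C: "\<And>k x. x \<in> K \<Longrightarrow> \<bar>P k x\<bar> \<le> C k"
    by metis
  \<comment> \<open>For \<open>t \<ge> 1\<close> every weight with index above \<open>L\<close> is
    at most \<open>t powr (e L - 1 / N)\<close>. The later terms together are then at most
    \<open>t powr e L * (t powr (- 1 / N) * D)\<close>, and the last factor tends to 0.\<close>
  define D where "D = (\<Sum>k = Suc L..n. C k)"
  have "((\<lambda>t. t powr (- 1 / real N) * D) \<longlongrightarrow> 0 * D) at_top"
    using exps by (intro tendsto_mult_right tendsto_neg_powr filterlim_ident) auto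
  then have "\<forall>\<^sub>F t in at_top. t powr (- 1 / real N) * D < c / 2"
    using c by (intro order_tendstoD) auto
  then obtain t0 where t0: "\<And>t. t0 \<le> t \<Longrightarrow> t powr (- 1 / real N) * D < c / 2"
    by (auto simp: eventually_at_top_linorder)
  \<comment> \<open>Beyond \<open>t0\<close> the later terms are small, beyond 1 powers of
    \<open>t\<close> are monotone in the exponent, and beyond \<open>ts\<close> the derivative
    within the half line is an ordinary one.\<close>
  define t1 where "t1 = max t0 (max 1 (ts + 1))"
  have t1: "t0 \<le> t1" "1 \<le> t1" "ts < t1"
    by (auto simp: t1_def)
  have slope: "c / 2 * (1 / t) \<le> sg * v' t" if t: "t1 \<le> t" for t
  proof -
    have t': "1 \<le> t" "ts \<le> t" "t0 \<le> t"
      using t t1 by auto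
    have "\<bar>\<Sum>k = Suc L..n. t powr e k * P k (z t)\<bar> \<le> (\<Sum>k = Suc L..n. t powr (e L - 1 / real N) * C k)"
    proof (rule order_trans[OF sum_abs], rule sum_mono)
      fix k assume "k \<in> {Suc L..n}"
      then have "real (M + L + 1) / real N \<le> real (M + k) / real N"
        by (intro divide_right_mono) auto
      then have "e k \<le> e L - 1 / real N"
        by (simp add: e_def add_divide_distrib)
      then show "\<bar>t powr e k * P k (z t)\<bar> \<le> t powr (e L - 1 / real N) * C k"
        using C[OF zK[OF t'(2)], of k] t' by (auto simp: abs_mult intro!: mult_mono powr_mono)
    qed
    also have "\<dots> = t powr e L * (t powr (- 1 / real N) * D)"
      using powr_add[of t "e L" "- 1 / real N"] by (simp add: D_def sum_distrib_left mult.assoc)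
    also have "\<dots> \<le> t powr e L * (c / 2)"
      using t0[OF t'(3)] by (intro mult_left_mono) auto
    finally have rest: "\<bar>\<Sum>k = Suc L..n. t powr e k * P k (z t)\<bar> \<le> t powr e L * (c / 2)" .
    have "v' t = t powr e L * P L (z t) + (\<Sum>k = Suc L..n. t powr e k * P k (z t))"
      unfolding v'_def by (rule sum.atLeast_Suc_atMost[OF exps(3)])
    then have "sg * v' t = t powr e L * (sg * P L (z t)) + sg * (\<Sum>k = Suc L..n. t powr e k * P k (z t))"
      by (simp add: algebra_simps)
    moreover have "t powr e L * c \<le> t powr e L * (sg * P L (z t))"
      unfolding c_def by (intro mult_left_mono x0 zK t') auto
    moreover have "\<bar>sg * (\<Sum>k = Suc L..n. t powr e k * P k (z t))\<bar> \<le> t powr e L * (c / 2)"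
      using rest sg(1) by (simp add: abs_mult)
    ultimately have "t powr e L * (c / 2) \<le> sg * v' t"
      by (simp add: abs_le_iff)
    \<comment> \<open>Here \<open>M + L \<le> N\<close> enters: it says that \<open>e L\<close> is
      at least -1, the borderline exponent whose integral still diverges.\<close>
    moreover have "t powr (- 1) \<le> t powr e L"
      using t' exps by (intro powr_mono) (auto simp: e_def field_simps)
    then have "c / 2 * t powr (- 1) \<le> c / 2 * t powr e L"
      using c by (intro mult_left_mono) auto
    then have "c / 2 * (1 / t) \<le> t powr e L * (c / 2)"
      using t' by (simp add: powr_minus_divide mult.commute)
    ultimately show ?thesis
      by linarith
  qed
  have mono: "sg * v t1 - c / 2 * ln t1 \<le> sg * v t - c / 2 * ln t" if "t1 \<le> t" for t
  proof (rule DERIV_nonneg_imp_nondecreasing[OF that])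
    fix x assume x: "t1 \<le> x" "x \<le> t"
    have "at x within {ts..} = at x"
      using x t1 by (intro at_within_interior) simp
    then have "(v has_real_derivative v' x) (at x)"
      using v[of x] x t1 by (simp add: v'_def e_def)
    then have "((\<lambda>t. sg * v t - c / 2 * ln t) has_real_derivative (sg * v' x - c / 2 * (1 / x))) (at x)"
      using x t1 by (auto intro!: derivative_eq_intros)
    then show "\<exists>y. ((\<lambda>t. sg * v t - c / 2 * ln t) has_real_derivative y) (at x) \<and> 0 \<le> y"
      using slope[OF x(1)] by auto
  qed
  have sgv: "\<bar>sg * v t\<bar> \<le> B" if "ts \<le> t" for t
    using B[OF that] sg(1) by (simp add: abs_mult)
  \<comment> \<open>A rise of \<open>ln t\<close> by more than \<open>4 * B / c\<close> forces
    \<open>sg * v\<close> to rise by more than \<open>2 * B\<close>, impossible for a function with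
    values between \<open>-B\<close> and \<open>B\<close>.\<close>
  have "\<forall>\<^sub>F t in at_top. ln t1 + 4 * B / c < ln t"
    using ln_at_top by (simp add: filterlim_at_top_dense)
  then obtain t where t: "t1 \<le> t" "ln t1 + 4 * B / c < ln t"
    by (metis eventually_at_top_linorder linear order_refl)
  have "4 * B / c < ln t - ln t1"
    using t(2) by simp
  then have "4 * B < c * (ln t - ln t1)"
    using c by (simp add: field_simps)
  also have "\<dots> \<le> 2 * (sg * v t - sg * v t1)"
    using mono[OF t(1)] by (simp add: field_simps)
  also have "sg * v t - sg * v t1 \<le> 2 * B"
    using sgv[of t] sgv[of t1] t t1 by (simp add: abs_le_iff)
  finally show False
    by simp
qed

section \<open>Exit from bounded domains\<close>

theorem truncated_system_exits:
  assumes smooth: "\<And>K. smooth_on UNIV (\<lambda>(r, \<theta>). \<Lambda> K r \<theta>)" "\<And>K. smooth_on UNIV (\<lambda>(r, \<theta>). \<Omega> K r \<theta>)"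
    and nz: "\<And>r \<theta>. \<Lambda> L r \<theta> \<noteq> 0"
    and exps: "0 < N" "M + L \<le> N" "L \<le> n"
    and D: "bounded D" and "0 < ts"
    and sol: "maximal_truncated_solution M N L n \<Lambda> \<Omega> ts J v \<phi>"
    and start: "(v ts, \<phi> ts) \<in> D"
  shows "\<exists>\<tau>\<in>J. ts < \<tau> \<and> (v \<tau>, \<phi> \<tau>) \<notin> D"
proof (rule ccontr)
  let ?f = "truncated_field M N L n \<Lambda> \<Omega>"
  let ?z = "\<lambda>t. (v t, \<phi> t)"
  assume stays: "\<not> (\<exists>\<tau>\<in>J. ts < \<tau> \<and> (v \<tau>, \<phi> \<tau>) \<notin> D)"
  have J: "is_interval J" "ts \<in> J" "J \<subseteq> {ts..}" and z: "ode_solution ?f J ?z"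
    using sol by (simp_all add: maximal_truncated_solution_def truncated_solution_iff_ode_solution)
  \<comment> \<open>The negated claim concerns only times after \<open>ts\<close>; the starting
    point itself lies in \<open>D\<close> by assumption.\<close>
  have zD: "?z t \<in> D" if "t \<in> J" for t
    using stays start that J(3) by (cases "t = ts") force+
  have "J = {ts..}"
  proof (rule ccontr)
    assume "J \<noteq> {ts..}"
    note continuation = bounded_solution_extends[OF J this z _ continuous_on_truncated_field[OF smooth \<open>0 < ts\<close>]]
    have bdd: "bounded (?z ` J)"
      using zD by (intro bounded_subset[OF D]) auto
    have lip: "\<exists>C. \<forall>t\<in>{T..T + 1}. C-lipschitz_on (cball z0 1) (?f t)" if "ts \<le> T" for T z0
      using that \<open>0 < ts\<close> by (intro truncated_field_locally_lipschitz smooth) simp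
    obtain J' z' where J': "is_interval J'" "J \<subset> J'" "J' \<subseteq> {ts..}" "ode_solution ?f J' z'"
      "\<And>t. t \<in> J \<Longrightarrow> z' t = ?z t"
      by (rule continuation[OF bdd lip]) blast+
    have "truncated_solution M N L n \<Lambda> \<Omega> J' (\<lambda>t. fst (z' t)) (\<lambda>t. snd (z' t))"
      using J'(4) by (simp add: truncated_solution_iff_ode_solution)
    moreover have "\<forall>t\<in>J. fst (z' t) = v t \<and> snd (z' t) = \<phi> t"
      using J'(5) by simp
    ultimately show False
      using sol J'(1-3) unfolding maximal_truncated_solution_def by blast
  qed
  define P where "P = (\<lambda>k (r, \<theta>). \<Lambda> k r \<theta>)"
  have P: "continuous_on S (P k)" for k S
    using continuous_on_subset[OF smooth_on_continuous_on[OF smooth(1)]] unfolding P_def by blast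
  obtain sg where sg: "\<bar>sg\<bar> = 1" "\<And>x. 0 < sg * P L x"
    using nonvanishing_has_sign[OF P, of L] nz by (auto simp: P_def)
  have "\<not> bounded (v ` {ts..})"
  \<comment> \<open>\<open>D\<close> need not be closed, so the coefficients are estimated on its
    closure; \<open>\<Lambda> L\<close> has its fixed sign there too, as it vanishes nowhere in the
    plane.\<close>
  proof (rule sign_definite_drift_unbounded[where P = P and z = ?z and K = "closure D",
        OF _ _ P sg(1) sg(2) exps])
    show "compact (closure D)"
      using D by simp
    show "?z t \<in> closure D" if "ts \<le> t" for t
      using zD[of t] closure_subset[of D] that \<open>J = {ts..}\<close> by auto
    show "(v has_real_derivative (\<Sum>k = L..n. t powr (- (real (M + k) / real N)) * P k (?z t)))
        (at t within {ts..})" if "ts \<le> t" for t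
      using sol that \<open>J = {ts..}\<close>
      by (simp add: maximal_truncated_solution_def truncated_solution_def P_def)
  qed
  moreover have "v ` {ts..} \<subseteq> fst ` D"
    using zD \<open>J = {ts..}\<close> by force
  then have "bounded (v ` {ts..})"
    using bounded_subset bounded_fst[OF D] by blast
  ultimately show False by simp
qed

theorem lemma5:
  fixes h a b q l p varkappa L M N :: nat
    and s \<sigma> vtheta \<mu> \<nu> \<kappa> E0 E1 t1 \<tau>0 :: real
    and u \<omega>c :: "nat \<Rightarrow> real"
    and S T \<omega> Istar :: "real \<Rightarrow> real"
    and x0 y0 X Y :: "real \<Rightarrow> real \<Rightarrow> real"
    and Xc Yc :: "nat \<Rightarrow> real \<Rightarrow> real"
    and f g F G \<A> \<B> :: "real \<Rightarrow> real \<Rightarrow> real \<Rightarrow> real \<Rightarrow> real"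
    and A B :: "nat \<Rightarrow> nat \<Rightarrow> nat \<Rightarrow> real \<Rightarrow> real"
    and AK BK \<rho> \<psi> :: "nat \<Rightarrow> real \<Rightarrow> real \<Rightarrow> real \<Rightarrow> real"
    and \<Lambda> \<Omega> :: "nat \<Rightarrow> real \<Rightarrow> real \<Rightarrow> real"
  assumes "2 \<le> h" "1 \<le> a" "a \<le> q" "1 \<le> b" "b \<le> q" "l \<le> p" "p \<le> 2 * h - 1" "0 < s"
    and "S = (\<lambda>t. s * t powr (1 + real b / real q))"
    and "admissible_perturbation q p l f A"
    and "admissible_perturbation q p (l + 1) g B"
    \<comment> \<open>energy-angle variables\<close>
    and "0 < E0" "closed_regular_levels h u E0" "periodic_family h u E0 x0 y0 T"
    and "\<omega> = (\<lambda>E. 2 * pi / T E)"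
    and "X = (\<lambda>\<phi> E. x0 (\<phi> / \<omega> E) E)" "Y = (\<lambda>\<phi> E. y0 (\<phi> / \<omega> E) E)"
    and "uniform_expansion UNIV (\<lambda>E \<phi>. X \<phi> E) (\<lambda>j. 1 / real (2 * h) - real j / real (2 * h)) Xc"
    and "uniform_expansion UNIV (\<lambda>E \<phi>. Y \<phi> E) (\<lambda>j. 1 / 2 - real j / real (2 * h)) Yc"
    and "uniform_expansion {()} (\<lambda>E _. \<omega> E)
           (\<lambda>j. (real h - 1) / real (2 * h) - real j / real (2 * h)) (\<lambda>j _. \<omega>c j)"
    and "\<And>j \<phi>. Xc j (\<phi> + 2 * pi) = Xc j \<phi>" "\<And>j \<phi>. Yc j (\<phi> + 2 * pi) = Yc j \<phi>"
    and "\<kappa> = sqrt 2 * real (2 * h) powr (1 / real (2 * h)) *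
           integral {-1..1} (\<lambda>z. 1 / sqrt (1 - z ^ (2 * h)))"
    and "\<omega>c 0 = 2 * pi / \<kappa>"
    and "F = (\<lambda>I \<phi> S t. f (X \<phi> I) (Y \<phi> I) S t * deriv (potential h u) (X \<phi> I) +
           g (X \<phi> I) (Y \<phi> I) S t * Y \<phi> I)"
    and "G = (\<lambda>I \<phi> S t. \<omega> I * (f (X \<phi> I) (Y \<phi> I) S t * deriv (\<lambda>E. Y \<phi> E) I -
           g (X \<phi> I) (Y \<phi> I) S t * deriv (\<lambda>E. X \<phi> E) I))"
    \<comment> \<open>rescaled variables\<close>
    and "1 \<le> varkappa"
    and "E0 \<le> E1" "\<And>E. E1 \<le> E \<Longrightarrow> 0 < deriv \<omega> E"
    and "0 < t1" "smooth_on {t1<..} Istar"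
    and "\<And>t. t1 \<le> t \<Longrightarrow> E1 \<le> Istar t \<and> \<omega> (Istar t) = deriv S t / real varkappa"
    and "\<sigma> = real b / real q * (real l - 1 + (real p - 1) / (real h - 1)) - real a / real q"
    and "vtheta = s * (1 + real b / real q)"
    and "\<mu> = (real b / real q - \<sigma>) / 2"
    and "\<nu> = 1 + real b / real q"
    and "real M = 2 * \<mu> * real q * (real h - 1)"
    and "real N = 2 * \<nu> * real q * (real h - 1)"
    and "\<And>r \<theta> \<zeta> \<tau> t I \<phi>. 0 < \<tau> \<Longrightarrow> t = (\<nu> * \<tau>) powr (1 / \<nu>) \<Longrightarrow> t1 < t \<Longrightarrow>
           I = Istar t * (1 + t powr (- \<mu>) * r) ^ (2 * h) \<Longrightarrow> \<phi> = \<theta> + \<zeta> / real varkappa \<Longrightarrow>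
           \<tau> powr (- (real M / real N)) * \<A> r \<theta> \<zeta> \<tau> =
             t powr (1 - \<nu> + \<mu>) *
             (t powr (- (real a / real q)) * F I \<phi> \<zeta> t /
                (real (2 * h) * Istar t * (1 + t powr (- \<mu>) * r) ^ (2 * h - 1)) -
              deriv Istar t / (real (2 * h) * Istar t) * (1 + t powr (- \<mu>) * r) +
              \<mu> * t powr (- \<mu> - 1) * r)"
    and "\<And>r \<theta> \<zeta> \<tau> t I \<phi>. 0 < \<tau> \<Longrightarrow> t = (\<nu> * \<tau>) powr (1 / \<nu>) \<Longrightarrow> t1 < t \<Longrightarrow>
           I = Istar t * (1 + t powr (- \<mu>) * r) ^ (2 * h) \<Longrightarrow> \<phi> = \<theta> + \<zeta> / real varkappa \<Longrightarrow>
           \<tau> powr (- (real M / real N)) * \<B> r \<theta> \<zeta> \<tau> =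
             t powr (1 - \<nu>) *
             (\<omega> I - \<omega> (Istar t) + t powr (- (real a / real q)) * G I \<phi> \<zeta> t)"
    and "\<And>R. uniform_expansion ({-R..R} \<times> UNIV \<times> UNIV) (\<lambda>\<tau> (r, \<theta>, \<zeta>). \<A> r \<theta> \<zeta> \<tau>)
           (\<lambda>K. - (real K / real N)) (\<lambda>K (r, \<theta>, \<zeta>). AK K r \<theta> \<zeta>)"
    and "\<And>R. uniform_expansion ({-R..R} \<times> UNIV \<times> UNIV) (\<lambda>\<tau> (r, \<theta>, \<zeta>). \<B> r \<theta> \<zeta> \<tau>)
           (\<lambda>K. - (real K / real N)) (\<lambda>K (r, \<theta>, \<zeta>). BK K r \<theta> \<zeta>)"
    and "\<And>K. \<exists>d c. \<forall>r \<theta> \<zeta>. AK K r \<theta> \<zeta> = (\<Sum>i\<le>d. c i \<theta> \<zeta> * r ^ i)"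
    and "\<And>K. \<exists>d c. \<forall>r \<theta> \<zeta>. BK K r \<theta> \<zeta> = (\<Sum>i\<le>d. c i \<theta> \<zeta> * r ^ i)"
    and "\<And>K r \<theta> \<zeta>. AK K r (\<theta> + 2 * pi) \<zeta> = AK K r \<theta> \<zeta> \<and> BK K r (\<theta> + 2 * pi) \<zeta> = BK K r \<theta> \<zeta>"
    and "\<And>K r \<theta> \<zeta>. AK K r \<theta> (\<zeta> + 2 * pi * real varkappa) = AK K r \<theta> \<zeta> \<and>
           BK K r \<theta> (\<zeta> + 2 * pi * real varkappa) = BK K r \<theta> \<zeta>"
    \<comment> \<open>averaging\<close>
    and "\<And>K. smooth_on UNIV (\<lambda>(r, \<theta>). \<Lambda> K r \<theta>)" "\<And>K. smooth_on UNIV (\<lambda>(r, \<theta>). \<Omega> K r \<theta>)"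
    and "\<And>K. smooth_on UNIV (\<lambda>(r, \<theta>, \<zeta>). \<rho> K r \<theta> \<zeta>)"
    and "\<And>K. smooth_on UNIV (\<lambda>(r, \<theta>, \<zeta>). \<psi> K r \<theta> \<zeta>)"
    and "\<And>K r \<theta>. \<Lambda> K r (\<theta> + 2 * pi) = \<Lambda> K r \<theta> \<and> \<Omega> K r (\<theta> + 2 * pi) = \<Omega> K r \<theta>"
    and "\<And>K r \<theta> \<zeta>. \<rho> K r (\<theta> + 2 * pi) \<zeta> = \<rho> K r \<theta> \<zeta> \<and> \<psi> K r (\<theta> + 2 * pi) \<zeta> = \<psi> K r \<theta> \<zeta>"
    and "\<And>K r \<theta> \<zeta>. \<rho> K r \<theta> (\<zeta> + 2 * pi * real varkappa) = \<rho> K r \<theta> \<zeta> \<and>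
           \<psi> K r \<theta> (\<zeta> + 2 * pi * real varkappa) = \<psi> K r \<theta> \<zeta>"
    and "\<And>K r \<theta>. ((\<lambda>\<zeta>. \<rho> K r \<theta> \<zeta>) has_integral 0) {0..2 * pi * real varkappa}"
    and "\<And>K r \<theta>. ((\<lambda>\<zeta>. \<psi> K r \<theta> \<zeta>) has_integral 0) {0..2 * pi * real varkappa}"
    and "averaging_identity M N vtheta AK BK \<Lambda> \<Omega> \<rho> \<psi>"
    \<comment> \<open>hypotheses of the claim\<close>
    and "-1 \<le> \<sigma>" "\<sigma> < real b / real q"
    and "int L \<le> min (int N - int M) (2 * int M - 1)"
    and "\<And>K r \<theta>. K < L \<Longrightarrow> \<Lambda> K r \<theta> = 0"
    and "\<exists>r \<theta>. \<Lambda> L r \<theta> \<noteq> 0"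
    and "\<And>r \<theta>. \<Lambda> L r \<theta> \<noteq> 0"
    and "0 < \<tau>0"
  shows "\<exists>n0\<ge>L. \<forall>n\<ge>n0. \<forall>D :: (real \<times> real) set. open D \<and> connected D \<and> bounded D \<longrightarrow>
           (\<forall>ts>\<tau>0. \<forall>J v \<phi>.
              maximal_truncated_solution M N L n \<Lambda> \<Omega> ts J v \<phi> \<and> (v ts, \<phi> ts) \<in> D \<longrightarrow>
              (\<exists>\<tau>\<in>J. ts < \<tau> \<and> (v \<tau>, \<phi> \<tau>) \<notin> D))"
\<comment> \<open>The witness for the threshold is \<open>L\<close> itself, so that the leading term
  is present in the truncated sum.\<close>
proof (intro exI[of _ L] conjI allI impI order_refl)
  have "0 < q"
    using \<open>1 \<le> a\<close> \<open>a \<le> q\<close> by simp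
  then have "0 < 2 * \<nu> * real q * (real h - 1)"
    using \<open>2 \<le> h\<close> \<open>\<nu> = 1 + real b / real q\<close> by (auto intro!: mult_pos_pos add_pos_nonneg)
  \<comment> \<open>Since division by zero yields 0, the case \<open>N = 0\<close> would make all
    exponents equal to 0 and the later terms would not be of lower order.\<close>
  then have "0 < N"
    using \<open>real N = 2 * \<nu> * real q * (real h - 1)\<close> by (metis of_nat_0_less_iff)
  have "M + L \<le> N"
    using \<open>int L \<le> min (int N - int M) (2 * int M - 1)\<close> by linarith
  fix n D ts J v \<phi>
  assume "L \<le> n" and D: "open D \<and> connected D \<and> bounded D" and "\<tau>0 < ts"
    and sol: "maximal_truncated_solution M N L n \<Lambda> \<Omega> ts J v \<phi> \<and> (v ts, \<phi> ts) \<in> D"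
  show "\<exists>\<tau>\<in>J. ts < \<tau> \<and> (v \<tau>, \<phi> \<tau>) \<notin> D"
  proof (rule truncated_system_exits)
    show "smooth_on UNIV (\<lambda>(r, \<theta>). \<Lambda> K r \<theta>)" for K by fact
    show "smooth_on UNIV (\<lambda>(r, \<theta>). \<Omega> K r \<theta>)" for K by fact
    show "\<Lambda> L r \<theta> \<noteq> 0" for r \<theta> by fact
    show "0 < ts"
      using \<open>0 < \<tau>0\<close> \<open>\<tau>0 < ts\<close> by simp
  qed (use sol D \<open>0 < N\<close> \<open>M + L \<le> N\<close> \<open>L \<le> n\<close> in auto)
qed

end
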